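(* Consider the problem $\min_{x\in\mathcal{Q}}\Phi(x)$ with $\Phi=F+h$ and a Legendre function $w$ with $\mathcal{Q}=\overline{\mathrm{dom}\,w}$, as set up in the context, and suppose that assumptions B1, B2 and B3 (stated in the context) hold, with constants $L>0$ in B1 and $\mu>0$ in B3. Let $\{x_k\}$ be generated by the NoLips algorithm $$x_{k+1}=\arg\min_{x\in\mathcal{Q}}\Big\{h(x)+\langle\nabla F(x_k),x-x_k\rangle+\frac{1}{\alpha}D_w(x,x_k)\Big\},\qquad k\ge 0,$$ started from $x_0\in\mathrm{int}\,\mathrm{dom}\,w$ with constant step size $0<\alpha\le 1/L$. Then, with $\Gamma_\alpha(x):=\Phi(x)-\Phi^*+\frac{1}{\alpha}\inf_{z\in\mathcal{X}}D_w(z,x)$, $$\Gamma_\alpha(x_k)\le\left(\frac{1}{1+\alpha\mu}\right)^k\Gamma_\alpha(x_0),\qquad\forall k\ge 0.$$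
   Context: Problem: $\mathcal{Q}\subseteq\mathbb{R}^d$ is a nonempty closed convex set with nonempty interior; $h:\mathbb{R}^d\to(-\infty,\infty]$ is proper, lower semicontinuous (lsc) and convex; $\Phi=F+h$. $\mathcal{X}$ is the set of minimizers of $\Phi$ over $\mathcal{Q}$, assumed nonempty and compact, and $\Phi^*$ is the optimal value. Legendre function: a proper lsc convex $w:\mathbb{R}^d\to(-\infty,\infty]$ is of Legendre type if $\mathrm{int}\,\mathrm{dom}\,w\ne\emptyset$, $w$ is differentiable on $\mathrm{int}\,\mathrm{dom}\,w$, $\|\nabla w(y_k)\|\to\infty$ for every sequence $\{y_k\}\subseteq\mathrm{int}\,\mathrm{dom}\,w$ converging to a boundary point of $\mathrm{dom}\,w$, and $w$ is strictly convex on $\mathrm{int}\,\mathrm{dom}\,w$. $w$ is a Legendre function with $\mathcal{Q}=\overline{\mathrm{dom}\,w}$. The Bregman distance is $D_w(y,x)=w(y)-w(x)-\langle\nabla w(x),y-x\rangle$ for $y\in\mathrm{dom}\,w$, $x\in\mathrm{int}\,\mathrm{dom}\,w$ (and $+\infty$ if $y\notin\mathrm{dom}\,w$). Assumptions (for a single component, $N=1$, $F=f_1$): B1. $F:\mathbb{R}^d\to(-\infty,\infty]$ is proper lsc convex with $\mathrm{dom}\,w\subseteq\mathrm{dom}\,F$, is differentiable on $\mathrm{int}\,\mathrm{dom}\,w$, and there is $L>0$ such that $Lw-F$ is convex on $\mathrm{int}\,\mathrm{dom}\,w$. B2. $\mathrm{dom}\,h\cap\mathrm{int}\,\mathrm{dom}\,w\ne\emptyset$,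 and $\partial h(x)\neq\emptyset$ for all $x\in\mathrm{dom}\,h\cap\mathrm{int}\,\mathrm{dom}\,w$. B3 (Bregman distance growth condition). There is $\mu>0$ such that $\Phi(y)-\Phi^*\ge\mu\inf_{z\in\mathcal{X}}D_w(z,y)$ for all $y\in\mathrm{int}\,\mathrm{dom}\,w$ (this implicitly assumes $\mathcal{X}\cap\mathrm{dom}\,w\ne\emptyset$). *)

theory Defs
  imports "HOL-Analysis.Analysis"
begin

text \<open>
  Functions with values in $(-\infty,\infty]$ are modelled as functions into \<^typ>\<open>ereal\<close>;
  the value $-\infty$ is excluded by properness.
\<close>

definition edom :: "('a \<Rightarrow> ereal) \<Rightarrow> 'a set" where
  "edom f = {x. f x < \<infinity>}"

definition proper_fun :: "('a \<Rightarrow> ereal) \<Rightarrow> bool" where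
  "proper_fun f \<longleftrightarrow> (\<forall>x. f x \<noteq> -\<infinity>) \<and> edom f \<noteq> {}"

definition lsc_fun :: "('a::topological_space \<Rightarrow> ereal) \<Rightarrow> bool" where
  "lsc_fun f \<longleftrightarrow> (\<forall>x. f x \<le> Liminf (at x) f)"

text \<open>
  To be used only for functions that avoid $-\infty$, so that the right-hand side is never of the
  form $\infty - \infty$.
\<close>

definition convex_fun :: "('a::real_vector \<Rightarrow> ereal) \<Rightarrow> bool" where
  "convex_fun f \<longleftrightarrow> (\<forall>x y u v. 0 \<le> u \<longrightarrow> 0 \<le> v \<longrightarrow> u + v = 1 \<longrightarrow>
     f (u *\<^sub>R x + v *\<^sub>R y) \<le> ereal u * f x + ereal v * f y)"

definition proper_lsc_convex :: "('a::real_normed_vector \<Rightarrow> ereal) \<Rightarrow> bool" where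
  "proper_lsc_convex f \<longleftrightarrow> proper_fun f \<and> lsc_fun f \<and> convex_fun f"

definition strictly_convex_on :: "'a::real_vector set \<Rightarrow> ('a \<Rightarrow> real) \<Rightarrow> bool" where
  "strictly_convex_on S f \<longleftrightarrow> convex S \<and>
     (\<forall>x\<in>S. \<forall>y\<in>S. \<forall>u>0. \<forall>v>0. x \<noteq> y \<longrightarrow> u + v = 1 \<longrightarrow>
        f (u *\<^sub>R x + v *\<^sub>R y) < u * f x + v * f y)"

text \<open>
  Differentiability and gradients are those of the real-valued part; they are only used at interior
  points of the effective domain of a proper function, where it agrees with the function nearby.
\<close>

definition differentiable_fun_on :: "('a::euclidean_space \<Rightarrow> ereal) \<Rightarrow> 'a set \<Rightarrow> bool" where
  "differentiable_fun_on f S \<longleftrightarrow> (\<forall>x\<in>S. (\<lambda>y. real_of_ereal (f y)) differentiable (at x))"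

definition grad :: "('a::euclidean_space \<Rightarrow> ereal) \<Rightarrow> 'a \<Rightarrow> 'a" where
  "grad f x = (THE g. GDERIV (\<lambda>y. real_of_ereal (f y)) x :> g)"

definition subdifferential :: "('a::real_inner \<Rightarrow> ereal) \<Rightarrow> 'a \<Rightarrow> 'a set" where
  "subdifferential f x = {g. \<forall>y. f y \<ge> f x + ereal (g \<bullet> (y - x))}"

definition legendre :: "('a::euclidean_space \<Rightarrow> ereal) \<Rightarrow> bool" where
  "legendre w \<longleftrightarrow> proper_lsc_convex w \<and> interior (edom w) \<noteq> {} \<and>
     differentiable_fun_on w (interior (edom w)) \<and>
     (\<forall>y l. (\<forall>k. y k \<in> interior (edom w)) \<longrightarrow> y \<longlonglongrightarrow> l \<longrightarrow> l \<in> frontier (edom w) \<longrightarrow>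
        filterlim (\<lambda>k. norm (grad w (y k))) at_top sequentially) \<and>
     strictly_convex_on (interior (edom w)) (\<lambda>y. real_of_ereal (w y))"

text \<open>
  The Bregman distance $D_w(y,x)$, meaningful for \<open>x\<close> in the interior of the domain of a proper
  \<open>w\<close>; then \<open>w x\<close> is finite, and the value is \<open>\<infinity>\<close> when \<open>y\<close> is outside the domain.
\<close>

definition bregman :: "('a::euclidean_space \<Rightarrow> ereal) \<Rightarrow> 'a \<Rightarrow> 'a \<Rightarrow> ereal" where
  "bregman w y x = w y - w x - ereal (grad w x \<bullet> (y - x))"

definition minimizers :: "('a \<Rightarrow> ereal) \<Rightarrow> 'a set \<Rightarrow> 'a set" where
  "minimizers f S = {x. is_arg_min f (\<lambda>y. y \<in> S) x}"

definition opt_value :: "('a \<Rightarrow> ereal) \<Rightarrow> 'a set \<Rightarrow> ereal" where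
  "opt_value f S = (INF x\<in>S. f x)"

definition bregman_inf :: "('a::euclidean_space \<Rightarrow> ereal) \<Rightarrow> 'a set \<Rightarrow> 'a \<Rightarrow> ereal" where
  "bregman_inf w X x = (INF z\<in>X. bregman w z x)"

definition Gamma_fun ::
  "('a::euclidean_space \<Rightarrow> ereal) \<Rightarrow> 'a set \<Rightarrow> ('a \<Rightarrow> ereal) \<Rightarrow> real \<Rightarrow> 'a \<Rightarrow> ereal" where
  "Gamma_fun \<Phi> Q w \<alpha> x =
     \<Phi> x - opt_value \<Phi> Q + ereal (1 / \<alpha>) * bregman_inf w (minimizers \<Phi> Q) x"

definition nolips_objective ::
  "('a::euclidean_space \<Rightarrow> ereal) \<Rightarrow> ('a \<Rightarrow> ereal) \<Rightarrow> ('a \<Rightarrow> ereal) \<Rightarrow> real \<Rightarrow> 'a \<Rightarrow> 'a \<Rightarrow> ereal" where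
  "nolips_objective F h w \<alpha> x y =
     h y + ereal (grad F x \<bullet> (y - x)) + ereal (1 / \<alpha>) * bregman w y x"

end

theory Submission
  imports Defs
begin

text \<open>
  Since the directional derivatives of a Legendre function at a boundary point, towards the
  interior, are \<open>-\<infinity>\<close>, every iterate stays in the interior of the domain of \<open>w\<close>. The optimality
  condition of the subproblem, the convexity of \<open>F\<close> and of \<open>L w - F\<close>, and the three-point identity
  for \<open>D\<^sub>w\<close> give
  \<open>\<Phi> x\<^sub>+ + D\<^sub>w z x\<^sub>+ / \<alpha> \<le> \<Phi> z + D\<^sub>w z x / \<alpha>\<close> for all \<open>z\<close>. Taking the infimum over the minimizers \<open>z\<close>
  gives \<open>\<Gamma> x\<^sub>+ \<le> d x / \<alpha>\<close>, where \<open>d x\<close> is the Bregman distance from the set of minimizers, while the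
  growth condition says \<open>\<Gamma> x \<ge> (\<mu> + 1 / \<alpha>) d x\<close>.
\<close>

section \<open>Real parts and gradients of extended-valued convex functions\<close>

lemma proper_funD:
  assumes "proper_fun f" "x \<in> edom f"
  shows "f x = ereal (real_of_ereal (f x))"
  using assms unfolding proper_fun_def edom_def by (cases "f x") auto

text \<open>Bridge from extended to real convexity. The restriction to \<open>edom f\<close> is
  essential: \<open>real_of_ereal\<close> sends \<infinity> to 0, which destroys convexity across
  the boundary of the domain.\<close>

lemma convex_fun_imp_convex_on:
  assumes "proper_fun f" "convex_fun f"
  shows "convex_on (edom f) (\<lambda>y. real_of_ereal (f y))"
proof -
  have bound: "f (u *\<^sub>R x + v *\<^sub>R y) \<le> ereal (u * real_of_ereal (f x) + v * real_of_ereal (f y))"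
    if "x \<in> edom f" "y \<in> edom f" "0 \<le> u" "0 \<le> v" "u + v = 1" for x y u v
  proof -
    have "f (u *\<^sub>R x + v *\<^sub>R y) \<le> ereal u * f x + ereal v * f y"
      using assms(2) that unfolding convex_fun_def by blast
    also have "\<dots> = ereal (u * real_of_ereal (f x) + v * real_of_ereal (f y))"
      using proper_funD[OF assms(1) that(1)] proper_funD[OF assms(1) that(2)]
      by (metis plus_ereal.simps(1) times_ereal.simps(1))
    finally show ?thesis .
  qed
  have conv: "convex (edom f)"
  proof (rule convexI)
    fix x y u v assume "x \<in> edom f" "y \<in> edom f" "0 \<le> (u::real)" "0 \<le> v" "u + v = 1"
    then have "f (u *\<^sub>R x + v *\<^sub>R y) \<le> ereal (u * real_of_ereal (f x) + v * real_of_ereal (f y))"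
      by (rule bound)
    then show "u *\<^sub>R x + v *\<^sub>R y \<in> edom f"
      by (auto simp: edom_def)
  qed
  show ?thesis
    unfolding convex_on_def
  proof (intro conjI conv ballI allI impI)
    fix x y u v assume *: "x \<in> edom f" "y \<in> edom f" "0 \<le> (u::real)" "0 \<le> v" "u + v = 1"
    then have "u *\<^sub>R x + v *\<^sub>R y \<in> edom f"
      using conv by (simp add: convexD)
    then show "real_of_ereal (f (u *\<^sub>R x + v *\<^sub>R y))
        \<le> u * real_of_ereal (f x) + v * real_of_ereal (f y)"
      using bound[OF *] proper_funD[OF assms(1)] by (metis ereal_less_eq(3))
  qed
qed

lemma GDERIV_unique:
  assumes "GDERIV f x :> g" "GDERIV f x :> g'"
  shows "g = g'"
proof -
  have "(\<lambda>h. h \<bullet> g) = (\<lambda>h. h \<bullet> g')"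
    using assms unfolding gderiv_def by (rule has_derivative_unique)
  then have "h \<bullet> g = h \<bullet> g'" for h by metis
  then show ?thesis by (metis vector_eq_ldot)
qed

lemma differentiable_imp_GDERIV:
  fixes f :: "'a::euclidean_space \<Rightarrow> real"
  assumes "f differentiable (at x)"
  obtains g where "GDERIV f x :> g"
proof -
  obtain D where D: "(f has_derivative D) (at x)"
    using assms unfolding differentiable_def by blast
  have lin: "linear D"
    using D by (rule has_derivative_linear)
  \<comment> \<open>Riesz representation of the functional \<open>D\<close>: its adjoint maps 1 to
    the representing vector.\<close>
  have "D = (\<lambda>h. h \<bullet> adjoint D 1)"
    using adjoint_works[OF lin, of _ 1] by (auto simp: inner_real_def)
  then show ?thesis
    using D that unfolding gderiv_def by metis
qed

lemma GDERIV_grad: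
  assumes "differentiable_fun_on f S" "x \<in> S"
  shows "GDERIV (\<lambda>y. real_of_ereal (f y)) x :> grad f x"
proof -
  obtain g where "GDERIV (\<lambda>y. real_of_ereal (f y)) x :> g"
    using assms differentiable_imp_GDERIV unfolding differentiable_fun_on_def by metis
  then show ?thesis
    unfolding grad_def by (metis theI GDERIV_unique)
qed

lemma GDERIV_directional:
  assumes "GDERIV f p :> g"
  shows "((\<lambda>t. (f (p + t *\<^sub>R v) - f p) / t) \<longlongrightarrow> g \<bullet> v) (at_right 0)"
proof -
  have "((\<lambda>t. f (p + t *\<^sub>R v)) has_derivative (\<lambda>t. (t *\<^sub>R v) \<bullet> g)) (at 0)"
    using assms unfolding gderiv_def
    by (intro has_derivative_compose[of "\<lambda>t. p + t *\<^sub>R v" "\<lambda>t. t *\<^sub>R v" 0 UNIV f, simplified])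
      (auto intro!: derivative_eq_intros)
  then have "((\<lambda>t. f (p + t *\<^sub>R v)) has_real_derivative g \<bullet> v) (at 0)"
    by (simp add: has_field_derivative_def inner_commute mult_commute_abs)
  then have "((\<lambda>t. (f (p + t *\<^sub>R v) - f p) / t) \<longlongrightarrow> g \<bullet> v) (at 0)"
    by (simp add: DERIV_def)
  then show ?thesis
    by (rule tendsto_within_subset) simp
qed

text \<open>Dividing by \<open>t\<close> and letting it tend to 0 from the right suffices. This
  turns minimality along a ray into first-order optimality.\<close>

lemma GDERIV_directional_ge:
  assumes "GDERIV f p :> g" "\<forall>\<^sub>F t in at_right 0. f p + t * c \<le> f (p + t *\<^sub>R v)"
  shows "c \<le> g \<bullet> v"
proof (rule tendsto_lowerbound[OF GDERIV_directional[OF assms(1)]])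
  show "\<forall>\<^sub>F t in at_right 0. c \<le> (f (p + t *\<^sub>R v) - f p) / t"
    using assms(2) eventually_at_right_less
    by eventually_elim (simp add: field_simps)
qed simp

text \<open>By convexity the difference quotients from \<open>x\<close> towards \<open>y\<close> are
  at most \<open>f y - f x\<close> for \<open>t < 1\<close>, and their limit is the directional
  derivative. The point \<open>y\<close> may lie on the boundary of \<open>S\<close>.\<close>

lemma convex_on_GDERIV_le:
  assumes "convex_on S f" "x \<in> S" "y \<in> S" "GDERIV f x :> g"
  shows "f x + g \<bullet> (y - x) \<le> f y"
proof -
  have "g \<bullet> (y - x) \<le> f y - f x"
  proof (rule tendsto_upperbound[OF GDERIV_directional[OF assms(4)]])
    have "\<forall>\<^sub>F t in at_right (0::real). t < 1"
      by (rule order_tendstoD(2)[OF tendsto_ident_at]) simp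
    then show "\<forall>\<^sub>F t in at_right 0. (f (x + t *\<^sub>R (y - x)) - f x) / t \<le> f y - f x"
      using eventually_at_right_less
    proof eventually_elim
      case (elim t)
      have "x + t *\<^sub>R (y - x) = (1 - t) *\<^sub>R x + t *\<^sub>R y"
        by (simp add: algebra_simps)
      then have "f (x + t *\<^sub>R (y - x)) \<le> (1 - t) * f x + t * f y"
        using convex_onD[OF assms(1), of t x y] elim assms by simp
      then show ?case
        using elim by (simp add: field_simps)
    qed
  qed simp
  then show ?thesis by simp
qed

section \<open>Legendre functions at the boundary of their domain\<close>

lemma convex_interior_segment:
  fixes p u :: "'a::euclidean_space"
  assumes "convex C" "u \<in> interior C" "p \<in> C" "0 < t" "t \<le> 1"
  shows "p + t *\<^sub>R (u - p) \<in> interior C"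
  using mem_interior_convex_shrink[OF assms]
  by (simp add: algebra_simps)

text \<open>
  Otherwise the gradients along the segment from \<open>p\<close> to \<open>u\<close> would stay bounded near \<open>p\<close>: the tangent
  planes there lie below \<open>w\<close> on a ball around \<open>u\<close>, on which \<open>w\<close> is bounded above.
\<close>

lemma legendre_boundary_slope:
  fixes w :: "'a::euclidean_space \<Rightarrow> ereal"
  assumes w: "legendre w" and p: "p \<in> edom w" and u: "u \<in> interior (edom w)"
    and slope: "\<And>t. 0 < t \<Longrightarrow> t \<le> 1 \<Longrightarrow>
      real_of_ereal (w p) + t * c \<le> real_of_ereal (w (p + t *\<^sub>R (u - p)))"
  shows "p \<in> interior (edom w)"
proof (rule ccontr)
  assume np: "p \<notin> interior (edom w)"
  define W where "W = (\<lambda>y. real_of_ereal (w y))"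
  have pw: "proper_fun w" and cf: "convex_fun w"
    and diff: "differentiable_fun_on w (interior (edom w))"
    using w by (auto simp: legendre_def proper_lsc_convex_def)
  have cW: "convex_on (edom w) W"
    unfolding W_def using pw cf by (rule convex_fun_imp_convex_on)
  then have conv: "convex (edom w)" by (rule convex_on_imp_convex)
  have gW: "GDERIV W y :> grad w y" if "y \<in> interior (edom w)" for y
    unfolding W_def using GDERIV_grad[OF diff that] .
  have "isCont W u"
    using gW[OF u] has_derivative_continuous unfolding gderiv_def by blast
  then obtain d where d: "d > 0" "\<And>v. dist v u < d \<Longrightarrow> dist (W v) (W u) < 1"
    unfolding continuous_at_eps_delta by (metis zero_less_one)
  obtain e where e: "e > 0" "ball u e \<subseteq> edom w"
    using u mem_interior by blast
  define r where "r = min d e / 2"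
  have r: "r > 0" "r < d" "r < e"
    using d e by (auto simp: r_def min_def)
  \<comment> \<open>A bound uniform in \<open>t\<close>: one \<open>\<bar>c\<bar>\<close> absorbs
    \<open>t * c\<close> in the lower bound on \<open>W y\<close>, the other absorbs
    \<open>(1 - t) * c\<close> in the slope term.\<close>
  define K where "K = (W u + 1 - W p + 2 * \<bar>c\<bar>) / r"
  have bound: "norm (grad w (p + t *\<^sub>R (u - p))) \<le> K" if t: "0 < t" "t \<le> 1" for t
  proof -
    define y where "y = p + t *\<^sub>R (u - p)"
    define g where "g = grad w y"
    \<comment> \<open>Moving from \<open>u\<close> along the direction of \<open>g\<close> makes the
      tangent plane at \<open>y\<close> gain exactly \<open>r * norm g\<close>. The case
      \<open>g = 0\<close> is harmless since \<open>sgn 0 = 0\<close>.\<close>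
    define v where "v = u + r *\<^sub>R sgn g"
    have y: "y \<in> interior (edom w)"
      unfolding y_def using convex_interior_segment[OF conv u p t] .
    then have yw: "y \<in> edom w"
      using interior_subset by blast
    have tangent: "W y + g \<bullet> (z - y) \<le> W z" if "z \<in> edom w" for z
      unfolding g_def using convex_on_GDERIV_le[OF cW yw that gW[OF y]] .
    have Wy: "W p + t * c \<le> W y"
      using slope[OF t] by (simp add: W_def y_def)
    \<comment> \<open>The tangent plane at \<open>y\<close>, evaluated back at \<open>p\<close>,
      converts the assumed lower bound on \<open>W y\<close> into a lower bound on the slope of
      \<open>g\<close> towards \<open>u\<close>.\<close>
    have "W y - t * (g \<bullet> (u - p)) \<le> W p"
      using tangent[OF p] by (simp add: y_def algebra_simps)
    with Wy have "t * c \<le> t * (g \<bullet> (u - p))" by linarith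
    with t have slope_y: "c \<le> g \<bullet> (u - p)" by simp
    have "dist v u \<le> r"
      using r by (simp add: v_def dist_norm norm_sgn)
    with r e d(2)[of v] have v: "v \<in> edom w" "W v < W u + 1"
      by (auto simp: dist_real_def dist_commute subset_iff)
    have "v - y = (1 - t) *\<^sub>R (u - p) + r *\<^sub>R sgn g"
      by (simp add: v_def y_def algebra_simps)
    moreover have "g \<bullet> sgn g = norm g"
      by (cases "g = 0") (simp_all add: sgn_div_norm dot_square_norm power2_eq_square)
    ultimately have "W y + (1 - t) * (g \<bullet> (u - p)) + r * norm g \<le> W v"
      using tangent[OF v(1)] by (simp add: inner_add_right)
    moreover have "(1 - t) * (g \<bullet> (u - p)) \<ge> - \<bar>c\<bar>"
    proof -
      have "(1 - t) * c \<le> (1 - t) * (g \<bullet> (u - p))"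
        using slope_y t by (intro mult_left_mono) auto
      moreover have "\<bar>(1 - t) * c\<bar> \<le> \<bar>c\<bar>"
        using t by (simp add: abs_mult mult_left_le_one_le)
      ultimately show ?thesis by linarith
    qed
    moreover have "\<bar>t * c\<bar> \<le> \<bar>c\<bar>"
      using t by (simp add: abs_mult mult_left_le_one_le)
    ultimately have "r * norm g \<le> W u + 1 - W p + 2 * \<bar>c\<bar>"
      using v(2) Wy by linarith
    then show ?thesis
      using r by (simp add: K_def g_def y_def field_simps)
  qed
  \<comment> \<open>The index shift keeps the parameter in \<open>(0, 1]\<close>, so every
    \<open>ys n\<close> is interior while the limit is \<open>p\<close>.\<close>
  define ys where "ys n = p + (1 / real (Suc n)) *\<^sub>R (u - p)" for n
  have lim: "ys \<longlonglongrightarrow> p + 0 *\<^sub>R (u - p)"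
    unfolding ys_def using lim_inverse_n' LIMSEQ_Suc
    by (intro tendsto_intros) blast
  have "p \<in> frontier (edom w)"
    using p np closure_subset by (auto simp: frontier_def)
  moreover have "ys n \<in> interior (edom w)" for n
    unfolding ys_def by (intro convex_interior_segment[OF conv u p]) auto
  ultimately have "filterlim (\<lambda>n. norm (grad w (ys n))) at_top sequentially"
    using w lim unfolding legendre_def by simp
  then have "\<forall>\<^sub>F n in sequentially. K < norm (grad w (ys n))"
    by (simp add: filterlim_at_top_dense)
  then obtain n where "K < norm (grad w (ys n))"
    by (auto simp: eventually_sequentially)
  with bound[of "1 / real (Suc n)"] show False
    by (simp add: ys_def)
qed

section \<open>Finiteness and sign of the Bregman distance; finiteness of the subproblem
  objective\<close>

lemma bregman_real:
  assumes "proper_fun w" "x \<in> edom w" "y \<in> edom w"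
  shows "bregman w y x
    = ereal (real_of_ereal (w y) - real_of_ereal (w x) - grad w x \<bullet> (y - x))"
  unfolding bregman_def
  by (subst proper_funD[OF assms(1,2)], subst proper_funD[OF assms(1,3)]) simp

lemma bregman_outside:
  assumes "proper_fun w" "x \<in> edom w" "y \<notin> edom w"
  shows "bregman w y x = \<infinity>"
  using proper_funD[OF assms(1,2)] assms(3)
  by (cases "w x") (auto simp: bregman_def edom_def)

lemma bregman_nonneg:
  fixes w :: "'a::euclidean_space \<Rightarrow> ereal"
  assumes "proper_fun w" "convex_fun w" "differentiable_fun_on w (interior (edom w))"
    and "x \<in> interior (edom w)"
  shows "0 \<le> bregman w y x"
proof (cases "y \<in> edom w")
  case True
  have x: "x \<in> edom w"
    using assms(4) interior_subset by blast
  have "0 \<le> real_of_ereal (w y) - real_of_ereal (w x) - grad w x \<bullet> (y - x)"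
    using convex_on_GDERIV_le[OF convex_fun_imp_convex_on[OF assms(1,2)] x True
        GDERIV_grad[OF assms(3,4)]] by simp
  then show ?thesis
    by (simp add: bregman_real[OF assms(1) x True])
next
  case False
  have "x \<in> edom w"
    using assms(4) interior_subset by blast
  with False show ?thesis
    using bregman_outside[OF assms(1)] by simp
qed

lemma nolips_objective_real:
  assumes "proper_fun w" "proper_fun h" "x \<in> edom w" "y \<in> edom w" "y \<in> edom h"
  shows "nolips_objective F h w \<alpha> x y = ereal (real_of_ereal (h y) + grad F x \<bullet> (y - x)
    + (real_of_ereal (w y) - real_of_ereal (w x) - grad w x \<bullet> (y - x)) / \<alpha>)"
  unfolding nolips_objective_def bregman_real[OF assms(1,3,4)]
  by (subst proper_funD[OF assms(2,5)]) simp

lemma nolips_objective_finiteD: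
  assumes "proper_fun w" "proper_fun h" "x \<in> edom w" "0 < \<alpha>"
    and "nolips_objective F h w \<alpha> x y < \<infinity>"
  shows "y \<in> edom w" "y \<in> edom h"
proof -
  have nh: "h y \<noteq> -\<infinity>" and nw: "w y \<noteq> -\<infinity>"
    using assms(1,2) by (auto simp: proper_fun_def)
  show "y \<in> edom w"
  proof (rule ccontr)
    assume "y \<notin> edom w"
    then have "bregman w y x = \<infinity>" by (rule bregman_outside[OF assms(1,3)])
    then show False
      using assms(4,5) nh by (cases "h y") (auto simp: nolips_objective_def)
  qed
  then have *: "bregman w y x
    = ereal (real_of_ereal (w y) - real_of_ereal (w x) - grad w x \<bullet> (y - x))"
    using bregman_real[OF assms(1,3)] by blast
  show "y \<in> edom h"
    using assms(5) unfolding nolips_objective_def * by (auto simp: edom_def)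
qed

section \<open>A single NoLips step: interiority, optimality, three-point inequality\<close>

text \<open>Along the segment from \<open>p\<close> to an interior point \<open>u\<close> of
  \<open>edom h\<close>, convexity of \<open>h\<close> makes the terms of the objective other than
  \<open>w\<close> grow at most linearly. Minimality at \<open>p\<close> then keeps \<open>w\<close>
  from falling faster than linearly, which \<open>legendre_boundary_slope\<close> rules out at a
  boundary point.\<close>

lemma nolips_step_interior:
  fixes w :: "'a::euclidean_space \<Rightarrow> ereal"
  assumes w: "legendre w" and h: "proper_fun h" "convex_fun h" and \<alpha>: "0 < \<alpha>"
    and ne: "edom h \<inter> interior (edom w) \<noteq> {}"
    and x: "x \<in> interior (edom w)"
    and p: "is_arg_min (nolips_objective F h w \<alpha> x) (\<lambda>y. y \<in> closure (edom w)) p"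
  shows "p \<in> interior (edom w)" "p \<in> edom h"
proof -
  have wp: "proper_fun w" "convex_fun w"
    using w by (auto simp: legendre_def proper_lsc_convex_def)
  obtain u where u: "u \<in> edom h" "u \<in> interior (edom w)"
    using ne by blast
  have sub: "y \<in> edom w" if "y \<in> interior (edom w)" for y
    using that interior_subset by blast
  have clos: "y \<in> closure (edom w)" if "y \<in> edom w" for y
    using that closure_subset by blast
  have min: "nolips_objective F h w \<alpha> x p \<le> nolips_objective F h w \<alpha> x y" if "y \<in> edom w" for y
    using p clos[OF that] by (auto simp: is_arg_min_def not_less)
  \<comment> \<open>A finite value at \<open>u\<close> makes the minimal value finite, which places
    \<open>p\<close> in both domains.\<close>
  have "nolips_objective F h w \<alpha> x u < \<infinity>"
    by (simp add: nolips_objective_real[OF wp(1) h(1) sub[OF x] sub[OF u(2)] u(1)])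
  with min[OF sub[OF u(2)]] have "nolips_objective F h w \<alpha> x p < \<infinity>"
    by (rule order_le_less_trans)
  then have p': "p \<in> edom w" "p \<in> edom h"
    using nolips_objective_finiteD[OF wp(1) h(1) sub[OF x] \<alpha>] by blast+
  then show "p \<in> edom h" by blast
  define W where "W = (\<lambda>y. real_of_ereal (w y))"
  define H where "H = (\<lambda>y. real_of_ereal (h y))"
  \<comment> \<open>Up to a constant, the objective is \<open>h\<close> plus \<open>w\<close>
    divided by \<alpha> plus the linear function with gradient \<open>s\<close>. Hence
    \<open>- c\<close> is \<alpha> times the chord slope of the part without
    \<open>w\<close>.\<close>
  define s where "s = grad F x - grad w x /\<^sub>R \<alpha>"
  define c where "c = - \<alpha> * (H u - H p + s \<bullet> (u - p))"
  have cw: "convex (edom w)" and cH: "convex_on (edom h) H"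
    using convex_fun_imp_convex_on[OF wp] convex_on_imp_convex convex_fun_imp_convex_on[OF h]
    by (auto simp: H_def)
  have "W p + t * c \<le> W (p + t *\<^sub>R (u - p))" if t: "0 < t" "t \<le> 1" for t
  proof -
    define y where "y = p + t *\<^sub>R (u - p)"
    have yc: "y = (1 - t) *\<^sub>R p + t *\<^sub>R u"
      by (simp add: y_def algebra_simps)
    have yw: "y \<in> edom w"
      unfolding y_def by (intro sub convex_interior_segment[OF cw u(2) p'(1) t])
    have yh: "y \<in> edom h"
      unfolding yc using convex_on_imp_convex[OF cH] u(1) p'(2) t by (simp add: convexD)
    have "H p + grad F x \<bullet> (p - x) + (W p - W x - grad w x \<bullet> (p - x)) / \<alpha>
      \<le> H y + grad F x \<bullet> (y - x) + (W y - W x - grad w x \<bullet> (y - x)) / \<alpha>"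
      using min[OF yw] nolips_objective_real[OF wp(1) h(1) sub[OF x], of _ F \<alpha>] p' yw yh
      by (simp add: H_def W_def)
    moreover have "s \<bullet> (y - p) = grad F x \<bullet> (y - x) - grad F x \<bullet> (p - x)
        - (grad w x \<bullet> (y - x) - grad w x \<bullet> (p - x)) / \<alpha>"
      by (simp add: s_def inner_diff_left inner_diff_right divide_inverse algebra_simps)
    ultimately have "H p + W p / \<alpha> \<le> H y + W y / \<alpha> + s \<bullet> (y - p)"
      by (simp add: diff_divide_distrib)
    moreover have "H y \<le> (1 - t) * H p + t * H u"
      unfolding yc using convex_onD[OF cH, of t p u] t p' u by simp
    moreover have "s \<bullet> (y - p) = t * (s \<bullet> (u - p))"
      by (simp add: y_def)
    ultimately have "W p / \<alpha> \<le> W y / \<alpha> + t * (H u - H p + s \<bullet> (u - p))"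
      by (simp add: algebra_simps)
    then have "W p \<le> W y + \<alpha> * (t * (H u - H p + s \<bullet> (u - p)))"
      using \<alpha> by (simp add: field_simps)
    then show ?thesis
      by (simp add: c_def y_def algebra_simps)
  qed
  then show "p \<in> interior (edom w)"
    unfolding W_def using legendre_boundary_slope[OF w p'(1) u(2), of c] by blast
qed

text \<open>Minimality along the ray from \<open>p\<close> to \<open>y\<close>, with
  \<open>h\<close> bounded by its chord, bounds the directional derivative of \<open>w\<close> at
  \<open>p\<close> from below. The outcome is a subgradient of \<open>h\<close> at \<open>p\<close>,
  namely the negative of the vector in the conclusion. Only points near \<open>p\<close> are
  compared, so \<open>y\<close> may lie outside \<open>edom w\<close>.\<close>

lemma nolips_step_optimality:
  fixes w :: "'a::euclidean_space \<Rightarrow> ereal"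
  assumes w: "proper_fun w" "differentiable_fun_on w (interior (edom w))"
    and h: "proper_fun h" "convex_fun h" and \<alpha>: "0 < \<alpha>"
    and x: "x \<in> interior (edom w)" and p: "p \<in> interior (edom w)" "p \<in> edom h"
    and min: "is_arg_min (nolips_objective F h w \<alpha> x) (\<lambda>y. y \<in> closure (edom w)) p"
    and y: "y \<in> edom h"
  shows "real_of_ereal (h p)
    \<le> real_of_ereal (h y) + (grad F x + (grad w p - grad w x) /\<^sub>R \<alpha>) \<bullet> (y - p)"
proof -
  define W where "W = (\<lambda>y. real_of_ereal (w y))"
  define H where "H = (\<lambda>y. real_of_ereal (h y))"
  define s where "s = grad F x - grad w x /\<^sub>R \<alpha>"
  define v where "v = y - p"
  have sub: "z \<in> edom w" if "z \<in> interior (edom w)" for z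
    using that interior_subset by blast
  have cH: "convex_on (edom h) H"
    unfolding H_def by (rule convex_fun_imp_convex_on[OF h])
  have "- \<alpha> * (H y - H p + s \<bullet> v) \<le> grad w p \<bullet> v"
  proof (rule GDERIV_directional_ge[where f = W and p = p])
    show "GDERIV W p :> grad w p"
      unfolding W_def by (rule GDERIV_grad[OF w(2) p(1)])
    \<comment> \<open>Since \<open>p\<close> is interior, the ray stays in the domain of
      \<open>w\<close> for small \<open>t\<close>.\<close>
    have "((\<lambda>t. p + t *\<^sub>R v) \<longlongrightarrow> p + 0 *\<^sub>R v) (at_right 0)"
      by (intro tendsto_intros)
    then have "\<forall>\<^sub>F t in at_right 0. p + t *\<^sub>R v \<in> interior (edom w)"
      using p(1) topological_tendstoD[OF _ open_interior] by simp
    moreover have "\<forall>\<^sub>F t in at_right (0::real). t < 1"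
      by (rule order_tendstoD(2)[OF tendsto_ident_at]) simp
    ultimately show "\<forall>\<^sub>F t in at_right 0.
        W p + t * (- \<alpha> * (H y - H p + s \<bullet> v)) \<le> W (p + t *\<^sub>R v)"
      using eventually_at_right_less
    proof eventually_elim
      case (elim t)
      define z where "z = p + t *\<^sub>R v"
      have zc: "z = (1 - t) *\<^sub>R p + t *\<^sub>R y"
        by (simp add: z_def v_def algebra_simps)
      have zw: "z \<in> edom w"
        using elim sub by (simp add: z_def)
      have zh: "z \<in> edom h"
        unfolding zc using convex_on_imp_convex[OF cH] y p(2) elim by (simp add: convexD)
      have "nolips_objective F h w \<alpha> x p \<le> nolips_objective F h w \<alpha> x z"
        using min zw closure_subset by (auto simp: is_arg_min_def not_less)
      then have "H p + grad F x \<bullet> (p - x) + (W p - W x - grad w x \<bullet> (p - x)) / \<alpha>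
        \<le> H z + grad F x \<bullet> (z - x) + (W z - W x - grad w x \<bullet> (z - x)) / \<alpha>"
        using nolips_objective_real[OF w(1) h(1) sub[OF x], of _ F \<alpha>] sub p zw zh
        by (simp add: H_def W_def)
      moreover have "s \<bullet> (z - p) = grad F x \<bullet> (z - x) - grad F x \<bullet> (p - x)
          - (grad w x \<bullet> (z - x) - grad w x \<bullet> (p - x)) / \<alpha>"
        by (simp add: s_def inner_diff_left inner_diff_right divide_inverse algebra_simps)
      ultimately have "H p + W p / \<alpha> \<le> H z + W z / \<alpha> + s \<bullet> (z - p)"
        by (simp add: diff_divide_distrib)
      moreover have "H z \<le> (1 - t) * H p + t * H y"
        unfolding zc using convex_onD[OF cH, of t p y] elim p y by simp
      moreover have "s \<bullet> (z - p) = t * (s \<bullet> v)"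
        by (simp add: z_def)
      ultimately have "W p / \<alpha> \<le> W z / \<alpha> + t * (H y - H p + s \<bullet> v)"
        by (simp add: algebra_simps)
      then have "W p \<le> W z + \<alpha> * (t * (H y - H p + s \<bullet> v))"
        using \<alpha> by (simp add: field_simps)
      then show ?case
        by (simp add: z_def algebra_simps)
    qed
  qed
  then show ?thesis
    using \<alpha> by (simp add: s_def H_def v_def[symmetric] inner_add_left inner_diff_left field_simps)
qed

text \<open>Stated for every \<open>z\<close> in extended arithmetic, so that minimizers outside
  \<open>edom w\<close> need no separate treatment when the infimum over \<open>z\<close> is
  taken.\<close>

lemma nolips_three_point:
  fixes w :: "'a::euclidean_space \<Rightarrow> ereal"
  assumes w: "legendre w" and h: "proper_fun h" "convex_fun h"
    and F: "proper_fun F" "convex_fun F" "edom w \<subseteq> edom F"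
      "differentiable_fun_on F (interior (edom w))"
    and L: "0 < L"
      "convex_on (interior (edom w)) (\<lambda>y. L * real_of_ereal (w y) - real_of_ereal (F y))"
    and \<alpha>: "0 < \<alpha>" "\<alpha> \<le> 1 / L"
    and x: "x \<in> interior (edom w)" and p: "p \<in> interior (edom w)" "p \<in> edom h"
    and min: "is_arg_min (nolips_objective F h w \<alpha> x) (\<lambda>y. y \<in> closure (edom w)) p"
  shows "F p + h p + ereal (1 / \<alpha>) * bregman w z p \<le> F z + h z + ereal (1 / \<alpha>) * bregman w z x"
proof -
  have pw: "proper_fun w" and cf: "convex_fun w"
    and diff: "differentiable_fun_on w (interior (edom w))"
    using w by (auto simp: legendre_def proper_lsc_convex_def)
  have sub: "y \<in> edom w" if "y \<in> interior (edom w)" for y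
    using that interior_subset by blast
  have nF: "F z \<noteq> -\<infinity>" and nh: "h z \<noteq> -\<infinity>"
    using F(1) h(1) by (auto simp: proper_fun_def)
  have D: "0 \<le> bregman w z x"
    by (rule bregman_nonneg[OF pw cf diff x])
  \<comment> \<open>Outside either domain the right-hand side is \<infinity>, because none of its
    summands is -\<infinity>.\<close>
  consider "z \<notin> edom w" | "z \<notin> edom h" | "z \<in> edom w" "z \<in> edom h" by blast
  then show ?thesis
  proof cases
    case 1
    then have "bregman w z x = \<infinity>" using bregman_outside[OF pw sub[OF x]] by blast
    then show ?thesis using nF nh \<alpha> by (cases "F z"; cases "h z") auto
  next
    case 2
    then have "h z = \<infinity>" by (simp add: edom_def)
    then show ?thesis using nF D \<alpha> by (cases "F z"; cases "bregman w z x") auto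
  next
    case 3
    define W where "W = (\<lambda>y. real_of_ereal (w y))"
    define H where "H = (\<lambda>y. real_of_ereal (h y))"
    define f where "f = (\<lambda>y. real_of_ereal (F y))"
    have mem: "p \<in> edom F" "z \<in> edom F"
      using F(3) sub p(1) 3(1) by blast+
    define E where "E y u = W y - W u - grad w u \<bullet> (y - u)" for y u
    have gW: "GDERIV W x :> grad w x" and gf: "GDERIV f x :> grad F x"
      unfolding W_def f_def using GDERIV_grad diff F(4) x by blast+
    \<comment> \<open>The tangent inequality for the convex function \<open>L * W - f\<close> is the
      descent lemma for \<open>f\<close>, with \<open>E p x\<close> replacing the squared
      distance.\<close>
    then have "GDERIV (\<lambda>y. L * W y - f y) x :> L *\<^sub>R grad w x - grad F x"
      unfolding gderiv_def by (auto intro!: derivative_eq_intros simp: inner_diff_right)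
    moreover have "convex_on (interior (edom w)) (\<lambda>y. L * W y - f y)"
      using L(2) by (simp add: W_def f_def)
    ultimately have "L * W x - f x + (L *\<^sub>R grad w x - grad F x) \<bullet> (p - x) \<le> L * W p - f p"
      using convex_on_GDERIV_le x p(1) by blast
    then have "f p \<le> f x + grad F x \<bullet> (p - x) + L * E p x"
      by (simp add: E_def inner_diff_left algebra_simps)
    moreover have "0 \<le> E p x"
      using convex_on_GDERIV_le[OF convex_fun_imp_convex_on[OF pw cf] sub[OF x] sub[OF p(1)]
          gW[unfolded W_def]]
      by (simp add: E_def W_def)
    moreover have "L \<le> 1 / \<alpha>"
      using L(1) \<alpha> by (simp add: field_simps)
    ultimately have "f p \<le> f x + grad F x \<bullet> (p - x) + E p x / \<alpha>"
      using mult_right_mono[of L "1 / \<alpha>" "E p x"] by simp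
    moreover have "f x + grad F x \<bullet> (z - x) \<le> f z"
      using convex_on_GDERIV_le[OF convex_fun_imp_convex_on[OF F(1,2)] _ _ gf[unfolded f_def], of z]
        sub[OF x] 3 F(3) by (auto simp: f_def)
    moreover have "H p \<le> H z + grad F x \<bullet> (z - p) + ((grad w p - grad w x) \<bullet> (z - p)) / \<alpha>"
      using nolips_step_optimality[OF pw diff h \<alpha>(1) x p min 3(2)]
      by (simp add: H_def inner_add_left divide_inverse mult.commute)
    \<comment> \<open>Three-point identity: it trades \<open>E p x\<close> and the gradient
      difference for the two distances from \<open>z\<close>.\<close>
    moreover have "E p x + (grad w p - grad w x) \<bullet> (z - p) = E z x - E z p"
      by (simp add: E_def inner_diff_left inner_diff_right)
    then have "E p x / \<alpha> + ((grad w p - grad w x) \<bullet> (z - p)) / \<alpha> = E z x / \<alpha> - E z p / \<alpha>"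
      by (metis add_divide_distrib diff_divide_distrib)
    ultimately have "f p + H p + E z p / \<alpha> \<le> f z + H z + E z x / \<alpha>"
      by (simp add: inner_diff_right)
    moreover have "F p = ereal (f p)" "F z = ereal (f z)" "h p = ereal (H p)" "h z = ereal (H z)"
      unfolding f_def H_def by (rule proper_funD, fact, fact)+
    moreover have "bregman w z p = ereal (E z p)" "bregman w z x = ereal (E z x)"
      using bregman_real[OF pw _ 3(1)] sub x p by (simp_all add: E_def W_def)
    ultimately show ?thesis by simp
  qed
qed

section \<open>Linear contraction from the growth condition\<close>

text \<open>
  \<open>a\<close> and \<open>b\<close> stand for the optimality gaps at \<open>x\<close> and \<open>x\<^sub>+\<close>,
  \<open>d\<close> and \<open>e\<close> for the distances to the set of minimizers.
\<close>

lemma growth_contraction: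
  fixes a b d e :: ereal and \<alpha> \<mu> :: real
  assumes "0 < \<alpha>" "0 < \<mu>" "0 \<le> d" "ereal \<mu> * d \<le> a"
    and "b + ereal (1 / \<alpha>) * e \<le> ereal (1 / \<alpha>) * d"
  shows "b + ereal (1 / \<alpha>) * e \<le> ereal (1 / (1 + \<alpha> * \<mu>)) * (a + ereal (1 / \<alpha>) * d)"
proof -
  have pos: "0 < 1 + \<alpha> * \<mu>"
    using assms by (simp add: add_pos_pos)
  have "ereal (1 / \<alpha>) * d \<le> ereal (1 / (1 + \<alpha> * \<mu>)) * (a + ereal (1 / \<alpha>) * d)"
  proof (cases "a = \<infinity>")
    case True
    with assms pos show ?thesis by (cases d) auto
  next
    case False
    \<comment> \<open>Since \<open>0 < \<mu>\<close>, an infinite \<open>d\<close> would force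
      \<open>a\<close> to be infinite.\<close>
    with assms obtain r where d: "d = ereal r"
      by (cases d; cases a) auto
    with False assms obtain s where a: "a = ereal s"
      by (cases a) auto
    have "\<mu> * r \<le> s"
      using assms(4) by (simp add: a d)
    then have "(1 + \<alpha> * \<mu>) * (r / \<alpha>) \<le> s + r / \<alpha>"
      using assms(1) by (simp add: field_simps)
    then show ?thesis
      using pos by (simp add: a d pos_le_divide_eq mult.commute)
  qed
  with assms(5) show ?thesis by (rule order_trans)
qed


theorem corollary4p1:
  fixes Q :: "'a::euclidean_space set"
    and F h \<Phi> w :: "'a \<Rightarrow> ereal"
    and x :: "nat \<Rightarrow> 'a"
    and L \<mu> \<alpha> :: real
  assumes Q: "Q \<noteq> {}" "closed Q" "convex Q" "interior Q \<noteq> {}"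
    and h: "proper_lsc_convex h"
    and \<Phi>: "\<Phi> = (\<lambda>y. F y + h y)"
    and X: "minimizers \<Phi> Q \<noteq> {}" "compact (minimizers \<Phi> Q)"
    and w: "legendre w" "Q = closure (edom w)"
    and B1: "proper_lsc_convex F" "edom w \<subseteq> edom F"
      "differentiable_fun_on F (interior (edom w))"
      "L > 0"
      "convex_on (interior (edom w)) (\<lambda>y. L * real_of_ereal (w y) - real_of_ereal (F y))"
    and B2: "edom h \<inter> interior (edom w) \<noteq> {}"
      "\<forall>y \<in> edom h \<inter> interior (edom w). subdifferential h y \<noteq> {}"
    and B3: "\<mu> > 0"
      "\<forall>y \<in> interior (edom w). \<Phi> y - opt_value \<Phi> Q \<ge> ereal \<mu> * bregman_inf w (minimizers \<Phi> Q) y"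
    and \<alpha>: "0 < \<alpha>" "\<alpha> \<le> 1 / L"
    and x0: "x 0 \<in> interior (edom w)"
    and step: "\<forall>k. is_arg_min (nolips_objective F h w \<alpha> (x k)) (\<lambda>y. y \<in> Q) (x (Suc k))"
  shows "\<forall>k. Gamma_fun \<Phi> Q w \<alpha> (x k) \<le> ereal ((1 / (1 + \<alpha> * \<mu>)) ^ k) * Gamma_fun \<Phi> Q w \<alpha> (x 0)"
proof -
  have pw: "proper_fun w" and cf: "convex_fun w"
    and diff: "differentiable_fun_on w (interior (edom w))"
    using w(1) by (auto simp: legendre_def proper_lsc_convex_def)
  have hp: "proper_fun h" "convex_fun h" and Fp: "proper_fun F" "convex_fun F"
    using h B1(1) by (auto simp: proper_lsc_convex_def)
  define X where "X = minimizers \<Phi> Q"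
  define d where "d = bregman_inf w X"
  define q where "q = 1 / (1 + \<alpha> * \<mu>)"
  have q: "0 \<le> q"
    using \<alpha>(1) B3(1) by (simp add: q_def)
  have opt: "\<Phi> z = opt_value \<Phi> Q" if "z \<in> X" for z
    unfolding opt_value_def using that
    by (intro antisym INF_greatest INF_lower)
      (auto simp: X_def minimizers_def is_arg_min_def not_less)
  \<comment> \<open>The optimal value lies below the finite value at a point supplied by
    \<open>B2\<close>, and it is attained at a minimizer, where \<open>\<Phi>\<close> is not
    -\<infinity>.\<close>
  obtain m where m: "opt_value \<Phi> Q = ereal m"
  proof -
    obtain z where "z \<in> X" using X(1) by (auto simp: X_def)
    moreover obtain u where u: "u \<in> edom h" "u \<in> interior (edom w)" using B2(1) by blast
    moreover from u have "u \<in> edom w" using interior_subset by blast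
    then have "u \<in> Q" "u \<in> edom F" using w(2) B1(2) closure_subset by blast+
    then have "opt_value \<Phi> Q \<le> \<Phi> u" "\<Phi> u < \<infinity>"
      using u(1) by (auto simp: opt_value_def \<Phi> edom_def intro: INF_lower)
    moreover have "\<Phi> z \<noteq> -\<infinity>"
      using hp(1) Fp(1) by (auto simp: \<Phi> proper_fun_def)
    ultimately show thesis
      using that opt by (cases "opt_value \<Phi> Q") auto
  qed
  have d_nonneg: "0 \<le> d y" if "y \<in> interior (edom w)" for y
    unfolding d_def bregman_inf_def by (intro INF_greatest bregman_nonneg[OF pw cf diff that])
  have int: "x k \<in> interior (edom w)" for k
  proof (induction k)
    case (Suc k)
    then show ?case
      using nolips_step_interior(1)[OF w(1) hp \<alpha>(1) B2(1) Suc] step w(2) by blast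
  qed (rule x0)
  \<comment> \<open>Only the new iterate is known to lie in \<open>edom h\<close>. The starting
    point may have infinite \<open>\<Phi>\<close>, a case that \<open>growth_contraction\<close>
    covers.\<close>
  have contract: "Gamma_fun \<Phi> Q w \<alpha> (x (Suc k)) \<le> ereal q * Gamma_fun \<Phi> Q w \<alpha> (x k)" for k
  proof -
    have min: "is_arg_min (nolips_objective F h w \<alpha> (x k)) (\<lambda>y. y \<in> closure (edom w)) (x (Suc k))"
      using step w(2) by simp
    have xh: "x (Suc k) \<in> edom h"
      by (rule nolips_step_interior(2)[OF w(1) hp \<alpha>(1) B2(1) int min])
    have "x (Suc k) \<in> edom F"
      using int interior_subset B1(2) by blast
    then obtain b where b: "\<Phi> (x (Suc k)) = ereal b"
      using proper_funD[OF Fp(1)] proper_funD[OF hp(1) xh] unfolding \<Phi>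
      by (metis plus_ereal.simps(1))
    \<comment> \<open>Multiplying by \<alpha> leaves the infimum alone on the right, so it can be
      bounded minimizer by minimizer. On the left the distance of the new iterate stays an infimum,
      which is at most its distance from the chosen \<open>z\<close>.\<close>
    have "ereal \<alpha> * (ereal (b - m) + ereal (1 / \<alpha>) * d (x (Suc k))) \<le> d (x k)"
      unfolding d_def bregman_inf_def[of w X "x k"]
    proof (rule INF_greatest)
      fix z assume z: "z \<in> X"
      let ?e = "bregman_inf w X (x (Suc k))"
      have e: "0 \<le> ?e" "?e \<le> bregman w z (x (Suc k))"
        using d_nonneg[OF int] z by (auto simp: d_def bregman_inf_def intro: INF_lower)
      have D: "0 \<le> bregman w z (x k)"
        by (rule bregman_nonneg[OF pw cf diff int])
      have "ereal b + ereal (1 / \<alpha>) * ?e \<le> ereal b + ereal (1 / \<alpha>) * bregman w z (x (Suc k))"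
        using e \<alpha>(1) by (intro add_left_mono ereal_mult_left_mono) auto
      also have "\<dots> \<le> ereal m + ereal (1 / \<alpha>) * bregman w z (x k)"
        using nolips_three_point[OF w(1) hp Fp B1(2-5) \<alpha> int int xh min, of z] b opt[OF z] m
        by (simp add: \<Phi>)
      finally show "ereal \<alpha> * (ereal (b - m) + ereal (1 / \<alpha>) * ?e) \<le> bregman w z (x k)"
        using e(1) D \<alpha>(1) by (cases ?e; cases "bregman w z (x k)") (auto simp: field_simps)
    qed
    then have "ereal (b - m) + ereal (1 / \<alpha>) * d (x (Suc k)) \<le> ereal (1 / \<alpha>) * d (x k)"
      using d_nonneg[OF int, of k] d_nonneg[OF int, of "Suc k"] \<alpha>(1)
      by (cases "d (x k)"; cases "d (x (Suc k))") (auto simp: field_simps)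
    moreover have "ereal \<mu> * d (x k) \<le> \<Phi> (x k) - ereal m"
      using B3(2) int by (simp add: d_def X_def m)
    ultimately show ?thesis
      using growth_contraction[OF \<alpha>(1) B3(1) d_nonneg[OF int]]
      by (simp add: Gamma_fun_def q_def d_def X_def m b)
  qed
  have "Gamma_fun \<Phi> Q w \<alpha> (x k) \<le> ereal (q ^ k) * Gamma_fun \<Phi> Q w \<alpha> (x 0)" for k
  proof (induction k)
    case (Suc k)
    have "Gamma_fun \<Phi> Q w \<alpha> (x (Suc k)) \<le> ereal q * Gamma_fun \<Phi> Q w \<alpha> (x k)"
      by (rule contract)
    also have "\<dots> \<le> ereal q * (ereal (q ^ k) * Gamma_fun \<Phi> Q w \<alpha> (x 0))"
      using Suc q by (intro ereal_mult_left_mono) auto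
    also have "\<dots> = ereal (q ^ Suc k) * Gamma_fun \<Phi> Q w \<alpha> (x 0)"
      by (simp add: mult.assoc[symmetric])
    finally show ?case .
  qed (simp add: one_ereal_def[symmetric])
  then show ?thesis
    by (simp add: q_def)
qed

end
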